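(* Let $s\ge 2$ and $t\ge 1$ be coprime integers, and let $\lambda\in\mathcal C_s$ be an $s$-core. For each congruence class $i\in\mathbb Z/t\mathbb Z$ (viewed as a subset of $\mathbb Z$), let $c_i=|\mathcal S(\lambda)\cap i|$. Let $\operatorname{Stab}_{s,t}(\lambda)$ be the stabiliser of $\lambda$ under the level $t$ action of $\tilde{\mathfrak S}_s$ on $\mathcal C_s$. Then \[ |\operatorname{Stab}_{s,t}(\lambda)|=\prod_{i\in\mathbb Z/t\mathbb Z}c_i!. \]
   Context: Let $\mathbb N=\{1,2,\dots\}$ and $s\circ t=\frac12(s-1)(t-1)$ (an integer, since $s,t$ are coprime). A partition is a weakly decreasing sequence $\lambda=(\lambda_1,\lambda_2,\dots)$ of non-negative integers, eventually $0$; its conjugate is $\lambda'$ with $\lambda'_i=|\{j\ge1:\lambda_j\ge i\}|$. For $(r,c)\in\mathbb N^2$ with $c\le\lambda_r$, the $(r,c)$-hook length of $\lambda$ is $1+(\lambda_r-r)+(\lambda'_c-c)$. $\lambda$ is an $s$-core if none of its hook lengths equals $s$; $\mathcal C_s$ is the set of all $s$-cores. The beta-set of $\lambda$ is $\mathcal B^\lambda=\{\lambda_i-i: i\in\mathbb N\}$. Affine symmetric group: $\tilde{\mathfrak S}_s$ is the group of permutations $w$ of $\mathbb Z$ with $w(m+s)=w(m)+s$ for all $m$ and $w(0)+\dots+w(s-1)=\binom s2$. Elements of $\mathbb Z/s\mathbb Z$ are regarded as congruence classes, i.e. subsets of $\mathbb Z$; for $i\in\mathbb Z/s\mathbb Z$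 and integers $a,b$, $ia+b$ denotes the class of $xa+b$ for $x\in i$. For $i\in\mathbb Z/s\mathbb Z$, $w_i\in\tilde{\mathfrak S}_s$ is given by $w_i(m)=m+1$ if $m\in i-1$, $w_i(m)=m-1$ if $m\in i$, and $w_i(m)=m$ otherwise; the $w_i$ generate $\tilde{\mathfrak S}_s$. Level $t$ action: the level $t$ action $w\mapsto\mathring w$ of $\tilde{\mathfrak S}_s$ on $\mathbb Z$ is the action (group homomorphism to permutations of $\mathbb Z$) determined on generators by $\mathring w_i(m)=m+t$ if $m\in(i-1)t-s\circ t$, $\mathring w_i(m)=m-t$ if $m\in it-s\circ t$, and $\mathring w_i(m)=m$ otherwise. The level $t$ action $w\mapsto\check w$ on $\mathcal C_s$ is defined by letting $\check w\lambda$ be the unique partition with $\mathcal B^{\check w\lambda}=\mathring w(\mathcal B^\lambda)$ (this is again an $s$-core). $s$-sets: for an $s$-core $\lambda$, the $s$-set of $\lambda$ is $\mathcal S(\lambda)=\{a_i: i\in\mathbb Z/s\mathbb Z\}$, where $a_i$ is the smallest integer in $i$ not in $\mathcal B^\lambda$. *)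

theory Defs
  imports "HOL-Algebra.Group_Action" "HOL-Number_Theory.Cong"
begin

text \<open>
  Partitions are indexed from 1, so \<open>lam i\<close> is \<open>\<lambda>\<^sub>i\<close>. The value at the unused index 0 is fixed by
  extensionality, so that equality of functions is equality of partitions.
\<close>

definition is_partition :: "(nat \<Rightarrow> nat) \<Rightarrow> bool" where
  "is_partition lam \<longleftrightarrow>
     lam \<in> extensional {1..} \<and> antimono_on {1..} lam \<and> (\<forall>\<^sub>F i in sequentially. lam i = 0)"

definition conjugate :: "(nat \<Rightarrow> nat) \<Rightarrow> nat \<Rightarrow> nat" where
  "conjugate lam i = card {j. j \<ge> 1 \<and> lam j \<ge> i}"

definition hook_length :: "(nat \<Rightarrow> nat) \<Rightarrow> nat \<Rightarrow> nat \<Rightarrow> int" where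
  "hook_length lam r c = 1 + (int (lam r) - int r) + (int (conjugate lam c) - int c)"

definition cores :: "nat \<Rightarrow> (nat \<Rightarrow> nat) set" where
  "cores s = {lam. is_partition lam \<and>
     (\<forall>r\<ge>1. \<forall>c\<ge>1. c \<le> lam r \<longrightarrow> hook_length lam r c \<noteq> int s)}"

definition beta_set :: "(nat \<Rightarrow> nat) \<Rightarrow> int set" where
  "beta_set lam = {int (lam i) - int i | i. i \<ge> 1}"

definition residue_classes :: "nat \<Rightarrow> int set set" where
  "residue_classes n = UNIV // {(a, b). [a = b] (mod int n)}"

text \<open>For a class \<open>i\<close> modulo \<open>n\<close>, the class \<open>i a + b\<close> modulo \<open>n\<close>.\<close>

definition class_affine :: "nat \<Rightarrow> int set \<Rightarrow> int \<Rightarrow> int \<Rightarrow> int set" where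
  "class_affine n i a b = {m. \<exists>x\<in>i. [m = x * a + b] (mod int n)}"

definition circ :: "nat \<Rightarrow> nat \<Rightarrow> int" where
  "circ s t = (int s - 1) * (int t - 1) div 2"

definition affine_sym :: "nat \<Rightarrow> (int \<Rightarrow> int) monoid" where
  "affine_sym s = BijGroup UNIV
     \<lparr>carrier := {w. bij w \<and> (\<forall>m. w (m + int s) = w m + int s) \<and>
                     (\<Sum>m\<in>{0..<int s}. w m) = int (s choose 2)}\<rparr>"

definition affine_gen :: "nat \<Rightarrow> int set \<Rightarrow> int \<Rightarrow> int" where
  "affine_gen s i m =
     (if m \<in> class_affine s i 1 (-1) then m + 1
      else if m \<in> i then m - 1
      else m)"

definition level_gen :: "nat \<Rightarrow> nat \<Rightarrow> int set \<Rightarrow> int \<Rightarrow> int" where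
  "level_gen s t i m =
     (if m \<in> class_affine s (class_affine s i 1 (-1)) (int t) (- circ s t) then m + int t
      else if m \<in> class_affine s i (int t) (- circ s t) then m - int t
      else m)"

text \<open>
  Extensionality only fixes the irrelevant values outside the group, making the action unique as a
  function.
\<close>

definition level_action :: "nat \<Rightarrow> nat \<Rightarrow> (int \<Rightarrow> int) \<Rightarrow> int \<Rightarrow> int" where
  "level_action s t = (THE \<phi>. \<phi> \<in> extensional (carrier (affine_sym s)) \<and>
     group_action (affine_sym s) UNIV \<phi> \<and>
     (\<forall>i\<in>residue_classes s. \<phi> (affine_gen s i) = level_gen s t i))"

definition core_action :: "nat \<Rightarrow> nat \<Rightarrow> (int \<Rightarrow> int) \<Rightarrow> (nat \<Rightarrow> nat) \<Rightarrow> nat \<Rightarrow> nat" where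
  "core_action s t w = (\<lambda>lam\<in>cores s.
     THE mu. is_partition mu \<and> beta_set mu = level_action s t w ` beta_set lam)"

definition s_set :: "nat \<Rightarrow> (nat \<Rightarrow> nat) \<Rightarrow> int set" where
  "s_set s lam = {(LEAST a. a \<in> i \<and> a \<notin> beta_set lam) | i. i \<in> residue_classes s}"

end

theory Submission
  imports Defs "HOL-Combinatorics.Permutations"
begin

text \<open>
  The level action has an explicit description. Every integer \<open>m\<close> lies in the class
  \<open>k t - s \<circ> t\<close> modulo \<open>s\<close> for an integer \<open>k\<close> that is unique modulo \<open>s\<close>, and \<open>w\<close> moves \<open>m\<close> to
  \<open>m + t (w k - k)\<close>. This formula is multiplicative in \<open>w\<close> and has the prescribed values on
  generators (\<open>level_perm_comp\<close>, \<open>level_perm_gen\<close>). It is the only such action because the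
  generators generate the affine symmetric group (\<open>affine_sym_induct\<close>).

  The beta-set \<open>B\<close> of an \<open>s\<close>-core is closed under subtraction of \<open>s\<close> (\<open>core_beta_set_closed\<close>), hence
  it is determined by the \<open>s\<close>-set \<open>A\<close>, which meets each class modulo \<open>s\<close> exactly once. The level
  action commutes with the shift by \<open>s\<close>, so \<open>w\<close> fixes the core iff it maps \<open>A\<close> onto itself
  (\<open>core_action_fixes_iff\<close>). That the image of \<open>B\<close> is the beta-set of a partition at all follows from
  a charge count: a set with \<open>s\<close>-set \<open>A\<close> comes from a partition iff the elements of \<open>A\<close> have the
  sum \<open>0 + 1 + \<dots> + (s - 1)\<close> (\<open>charge_free_abacus\<close>), and \<open>w\<close> preserves this sum since its
  displacements over a period add up to \<open>0\<close>.

  An element \<open>w\<close> of the stabiliser restricts to a permutation of \<open>A\<close> that moves each element by a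
  multiple of \<open>t\<close>. Conversely, since \<open>A\<close> meets every class modulo \<open>s\<close>, such a permutation
  prescribes the displacement of \<open>w\<close> on every class, and the resulting \<open>w\<close> is a unique element of
  the affine symmetric group (\<open>affine_from_permutation\<close>, \<open>level_perm_determined\<close>). So the stabiliser
  has as many elements as there are permutations of \<open>A\<close> that preserve the classes modulo \<open>t\<close>, and these
  are independent permutations of the sets \<open>A \<inter> i\<close>.
\<close>

section \<open>Periodic functions and transversals of the residue classes\<close>

lemma periodic_cong:
  fixes f :: "int \<Rightarrow> 'a"
  assumes per: "\<And>m. f (m + p) = f m" and "[m = n] (mod p)"
  shows "f m = f n"
proof -
  have nat: "f (m + p * int j) = f m" for m j
  proof (induction j)
    case (Suc j)
    have "f (m + p * int (Suc j)) = f ((m + p * int j) + p)"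
      by (simp add: algebra_simps)
    then show ?case
      using per Suc by simp
  qed simp
  obtain k where k: "n = m + p * k"
    using assms(2) by (auto simp: cong_iff_lin)
  show ?thesis
  proof (cases "k \<ge> 0")
    case True
    then show ?thesis
      using nat[of m "nat k"] k by simp
  next
    case False
    then show ?thesis
      using nat[of n "nat (- k)"] k by (simp add: algebra_simps)
  qed
qed

definition transversal :: "nat \<Rightarrow> int set \<Rightarrow> bool" where
  "transversal s A \<longleftrightarrow> bij_betw (\<lambda>a. a mod int s) A {0..<int s}"

lemma transversal_finite: "transversal s A \<Longrightarrow> finite A"
  unfolding transversal_def using bij_betw_finite by blast

lemma transversal_unique:
  "transversal s A \<Longrightarrow> a \<in> A \<Longrightarrow> b \<in> A \<Longrightarrow> [a = b] (mod int s) \<Longrightarrow> a = b"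
  unfolding transversal_def bij_betw_def inj_on_def cong_def by blast

lemma transversal_ex:
  assumes "transversal s A" "s > 0"
  shows "\<exists>a\<in>A. [a = m] (mod int s)"
proof -
  have "m mod int s \<in> (\<lambda>a. a mod int s) ` A"
    using assms by (simp add: transversal_def bij_betw_def)
  then show ?thesis
    by (auto simp: cong_def)
qed

lemma transversalI_card:
  assumes "finite A" "card A = s" "s > 0"
    and inj: "\<And>a b. a \<in> A \<Longrightarrow> b \<in> A \<Longrightarrow> [a = b] (mod int s) \<Longrightarrow> a = b"
  shows "transversal s A"
  unfolding transversal_def
proof (rule bij_betw_imageI)
  show inj': "inj_on (\<lambda>a. a mod int s) A"
    using inj by (auto simp: inj_on_def cong_def)
  show "(\<lambda>a. a mod int s) ` A = {0..<int s}"
    by (rule card_subset_eq) (use assms(2,3) card_image[OF inj'] in auto)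
qed

lemma transversalI:
  assumes "s > 0"
    and inj: "\<And>a b. a \<in> A \<Longrightarrow> b \<in> A \<Longrightarrow> [a = b] (mod int s) \<Longrightarrow> a = b"
    and ex: "\<And>m. \<exists>a\<in>A. [a = m] (mod int s)"
  shows "transversal s A"
  unfolding transversal_def
proof (rule bij_betw_imageI)
  show "inj_on (\<lambda>a. a mod int s) A"
    using inj by (auto simp: inj_on_def cong_def)
  show "(\<lambda>a. a mod int s) ` A = {0..<int s}"
  proof (intro equalityI subsetI)
    fix x assume x: "x \<in> {0..<int s}"
    obtain a where "a \<in> A" "[a = x] (mod int s)"
      using ex by blast
    then have "a mod int s = x"
      using x by (simp add: cong_def)
    then show "x \<in> (\<lambda>a. a mod int s) ` A"
      using \<open>a \<in> A\<close> by blast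
  qed (use assms(1) in auto)
qed

lemma transversal_card: "transversal s A \<Longrightarrow> card A = s"
  unfolding transversal_def using bij_betw_same_card by fastforce

lemma transversal_window:
  assumes "s > 0"
  shows "transversal s {x..<x + int s}"
proof (rule transversalI_card)
  fix a b assume ab: "a \<in> {x..<x + int s}" "b \<in> {x..<x + int s}" "[a = b] (mod int s)"
  have "(a - x) mod int s = (b - x) mod int s"
    using cong_diff[OF ab(3) cong_refl[of x]] by (simp add: cong_def)
  then show "a = b"
    using ab by simp
qed (use assms in auto)

lemma sum_transversal:
  fixes f :: "int \<Rightarrow> int"
  assumes "transversal s A" and per: "\<And>m. f (m + int s) = f m"
  shows "(\<Sum>a\<in>A. f a) = (\<Sum>m\<in>{0..<int s}. f m)"
proof -
  have "(\<Sum>a\<in>A. f a) = (\<Sum>a\<in>A. f (a mod int s))"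
  proof (rule sum.cong[OF refl])
    fix a
    have "[a = a mod int s] (mod int s)"
      by (simp add: cong_def)
    with per show "f a = f (a mod int s)"
      by (rule periodic_cong[where f = f and p = "int s"])
  qed
  also have "\<dots> = (\<Sum>m\<in>{0..<int s}. f m)"
    using assms(1) unfolding transversal_def by (rule sum.reindex_bij_betw)
  finally show ?thesis .
qed

section \<open>The affine symmetric group\<close>

lemma sum_initial_residues: "(\<Sum>m\<in>{0..<int s}. m) = int (s choose 2)"
proof -
  have "(\<Sum>m\<in>{0..<int s}. m) = (\<Sum>m<s. int m)"
    by (rule sum.reindex_bij_witness[of _ int nat]) auto
  also have "\<dots> = int (s choose 2)"
    by (induction s) (auto simp: numeral_2_eq_2)
  finally show ?thesis .
qed

text \<open>
  The normalisation of the sum over a period says that the displacements \<open>w m - m\<close> add up to \<open>0\<close>.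
  The displacement is a periodic function, so it can be summed over any transversal, and this
  is the form of the condition that survives composition and inversion.
\<close>

lemma affine_sym_iff:
  "w \<in> carrier (affine_sym s) \<longleftrightarrow>
     bij w \<and> (\<forall>m. w (m + int s) = w m + int s) \<and> (\<Sum>m\<in>{0..<int s}. w m - m) = 0"
  by (auto simp: affine_sym_def sum_subtractf sum_initial_residues)

lemma affine_bij: "w \<in> carrier (affine_sym s) \<Longrightarrow> bij w"
  and affine_shift: "w \<in> carrier (affine_sym s) \<Longrightarrow> w (m + int s) = w m + int s"
  and affine_sum_zero: "w \<in> carrier (affine_sym s) \<Longrightarrow> (\<Sum>m\<in>{0..<int s}. w m - m) = 0"
  by (simp_all add: affine_sym_iff)

lemma displacement_cong:
  assumes "\<And>m. w (m + int s) = w m + int s" and "[m = n] (mod int s)"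
  shows "w m - m = w n - n"
  by (rule periodic_cong[where p = "int s"]) (use assms in auto)

lemma affine_displacement_cong:
  assumes w: "w \<in> carrier (affine_sym s)" and "[m = n] (mod int s)"
  shows "w m - m = w n - n"
  using affine_shift[OF w] assms(2) by (rule displacement_cong)

text \<open>
  An injective map that commutes with the shift by \<open>s\<close> induces an injective map on residue classes.
  This is what makes images of transversals transversals again.
\<close>

lemma shift_commuting_cong_iff:
  assumes "inj w" and shift: "\<And>m. w (m + int s) = w m + int s"
  shows "[w m = w n] (mod int s) \<longleftrightarrow> [m = n] (mod int s)"
proof
  assume "[m = n] (mod int s)"
  moreover from this have "w m - w n = m - n"
    using displacement_cong[of w s m n] shift by simp
  ultimately show "[w m = w n] (mod int s)"
    by (simp add: cong_iff_dvd_diff)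
next
  assume "[w m = w n] (mod int s)"
  then obtain k where k: "w n = w m + int s * k"
    by (auto simp: cong_iff_lin)
  have "w (m + int s * k) - (m + int s * k) = w m - m"
    by (rule displacement_cong[of w, OF shift]) (simp add: cong_iff_dvd_diff)
  then have "w (m + int s * k) = w n"
    using k by simp
  then have "n = m + int s * k"
    using assms(1) by (simp add: inj_eq)
  then show "[m = n] (mod int s)"
    by (auto simp: cong_iff_lin)
qed

lemma transversal_image:
  assumes "s > 0" "transversal s A" "inj w" and shift: "\<And>m. w (m + int s) = w m + int s"
  shows "transversal s (w ` A)"
proof (rule transversalI_card)
  show "card (w ` A) = s"
    using transversal_card[OF assms(2)] assms(3)
    by (metis card_image inj_on_subset subset_UNIV)
  fix x y assume "x \<in> w ` A" "y \<in> w ` A" and xy: "[x = y] (mod int s)"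
  then obtain a b where ab: "a \<in> A" "x = w a" "b \<in> A" "y = w b"
    by blast
  then have "[a = b] (mod int s)"
    using xy shift_commuting_cong_iff[of w, OF assms(3) shift] by simp
  then show "x = y"
    using ab transversal_unique[OF assms(2)] by blast
qed (use assms transversal_finite in auto)

lemma affine_comp_closed:
  assumes "s > 0" and v: "v \<in> carrier (affine_sym s)" and w: "w \<in> carrier (affine_sym s)"
  shows "v \<circ> w \<in> carrier (affine_sym s)"
proof -
  let ?R = "{0..<int s}"
  have inj: "inj w"
    using affine_bij[OF w] by (rule bij_is_inj)
  have R: "transversal s ?R"
    using transversal_window[OF assms(1), of 0] by simp
  have "(\<Sum>m\<in>?R. v (w m) - w m) = (\<Sum>x\<in>w ` ?R. v x - x)"
    using inj by (subst sum.reindex) (auto intro: inj_on_subset)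
  also have "\<dots> = (\<Sum>m\<in>?R. v m - m)"
    by (rule sum_transversal[OF transversal_image[OF assms(1) R inj affine_shift[OF w]]])
      (simp add: affine_shift[OF v])
  finally have "(\<Sum>m\<in>?R. v (w m) - w m) + (\<Sum>m\<in>?R. w m - m) = 0"
    using affine_sum_zero[OF v] affine_sum_zero[OF w] by simp
  then have "(\<Sum>m\<in>?R. v (w m) - m) = 0"
    by (simp flip: sum.distrib)
  then show ?thesis
    using affine_bij[OF v] affine_bij[OF w]
    by (auto simp: affine_sym_iff bij_comp affine_shift[OF v] affine_shift[OF w])
qed

lemma affine_inv_closed:
  assumes "s > 0" and w: "w \<in> carrier (affine_sym s)"
  shows "inv_into UNIV w \<in> carrier (affine_sym s)"
proof -
  let ?R = "{0..<int s}"
  have bij: "bij w"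
    using w by (rule affine_bij)
  have inj: "inj w"
    using bij by (rule bij_is_inj)
  have w_inv: "w (inv_into UNIV w m) = m" for m
    using bij by (simp add: bij_is_surj surj_f_inv_f)
  have inv_w: "inv_into UNIV w (w m) = m" for m
    using inj by simp
  have shift: "inv_into UNIV w (m + int s) = inv_into UNIV w m + int s" for m
    by (metis w_inv inv_w affine_shift[OF w])
  have R: "transversal s ?R"
    using transversal_window[OF assms(1), of 0] by simp
  have "(\<Sum>m\<in>?R. inv_into UNIV w m - m) = (\<Sum>x\<in>w ` ?R. inv_into UNIV w x - x)"
    by (rule sum_transversal[OF transversal_image[OF assms(1) R inj affine_shift[OF w]], symmetric])
      (simp add: shift)
  also have "\<dots> = (\<Sum>m\<in>?R. m - w m)"
    using inj by (subst sum.reindex) (auto intro: inj_on_subset)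
  also have "\<dots> = 0"
    using affine_sum_zero[OF w] by (simp add: sum_subtractf)
  finally show ?thesis
    using bij by (auto simp: affine_sym_iff bij_imp_bij_inv shift)
qed

lemma mult_BijGroup_UNIV:
  "f \<in> carrier (BijGroup UNIV) \<Longrightarrow> g \<in> carrier (BijGroup UNIV) \<Longrightarrow>
   f \<otimes>\<^bsub>BijGroup UNIV\<^esub> g = f \<circ> g"
  by (auto simp: BijGroup_def compose_def)

lemma carrier_BijGroup_UNIV: "carrier (BijGroup UNIV) = {f. bij f}"
  by (auto simp: BijGroup_def Bij_def)

lemma affine_mult:
  "v \<in> carrier (affine_sym s) \<Longrightarrow> w \<in> carrier (affine_sym s) \<Longrightarrow>
   v \<otimes>\<^bsub>affine_sym s\<^esub> w = v \<circ> w"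
  using mult_BijGroup_UNIV[of v w]
  by (simp add: affine_bij carrier_BijGroup_UNIV) (simp add: affine_sym_def)

lemma id_affine: "(\<lambda>x. x) \<in> carrier (affine_sym s)"
  using bij_id by (simp add: affine_sym_iff id_def)

lemma group_affine_sym:
  assumes "s > 0"
  shows "group (affine_sym s)"
proof -
  interpret B: group "BijGroup (UNIV :: int set)"
    by (rule group_BijGroup)
  let ?C = "carrier (affine_sym s)"
  have "subgroup ?C (BijGroup UNIV)"
  proof
    show "?C \<subseteq> carrier (BijGroup UNIV)"
      by (auto simp: carrier_BijGroup_UNIV affine_bij)
    show "\<one>\<^bsub>BijGroup UNIV\<^esub> \<in> ?C"
      using id_affine by (simp add: BijGroup_def restrict_def)
    fix v assume v: "v \<in> ?C"
    then have "bij v"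
      by (rule affine_bij)
    then have "inv\<^bsub>BijGroup UNIV\<^esub> v = inv_into UNIV v"
      by (subst inv_BijGroup) (auto simp: Bij_def)
    then show "inv\<^bsub>BijGroup UNIV\<^esub> v \<in> ?C"
      using affine_inv_closed[OF assms v] by simp
    fix w assume w: "w \<in> ?C"
    show "v \<otimes>\<^bsub>BijGroup UNIV\<^esub> w \<in> ?C"
      using affine_comp_closed[OF assms v w] affine_bij[OF v] affine_bij[OF w]
      by (simp add: mult_BijGroup_UNIV carrier_BijGroup_UNIV)
  qed
  then have "group (BijGroup UNIV\<lparr>carrier := ?C\<rparr>)"
    by (rule B.subgroup_imp_group)
  then show ?thesis
    by (simp add: affine_sym_def)
qed

section \<open>The generators determine an action\<close>

definition cong_class :: "nat \<Rightarrow> int \<Rightarrow> int set" where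
  "cong_class n x = {m. [m = x] (mod int n)}"

lemma mem_cong_class: "m \<in> cong_class n x \<longleftrightarrow> [m = x] (mod int n)"
  by (simp add: cong_class_def)

lemma residue_classes_eq: "residue_classes n = range (cong_class n)"
  by (auto simp: residue_classes_def quotient_def cong_class_def cong_sym_eq)

lemma class_affine_cong_class: "class_affine n (cong_class n x) a b = cong_class n (x * a + b)"
proof -
  have "[m = x * a + b] (mod int n)"
    if "[m = y * a + b] (mod int n)" "[y = x] (mod int n)" for m y
    using that by (meson cong_add cong_refl cong_scalar_right cong_trans)
  then show ?thesis
    unfolding class_affine_def cong_class_def using cong_refl by blast
qed

lemma affine_gen_class:
  "affine_gen s (cong_class s x) m =
     (if [m = x - 1] (mod int s) then m + 1 else if [m = x] (mod int s) then m - 1 else m)"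
  by (simp add: affine_gen_def class_affine_cong_class mem_cong_class)

lemma level_gen_class:
  "level_gen s t (cong_class s x) m =
     (if [m = (x - 1) * int t - circ s t] (mod int s) then m + int t
      else if [m = x * int t - circ s t] (mod int s) then m - int t else m)"
  by (simp add: level_gen_def class_affine_cong_class mem_cong_class)

lemma not_cong_pred:
  assumes "s \<ge> 2"
  shows "\<not> [x - 1 = x] (mod int s)" "\<not> [x = x - 1] (mod int s)"
  using assms by (auto simp: cong_iff_dvd_diff)

lemma affine_gen_involution:
  assumes "s \<ge> 2"
  shows "affine_gen s (cong_class s x) (affine_gen s (cong_class s x) m) = m"
proof -
  have up: "[m + 1 = x] (mod int s)" if "[m = x - 1] (mod int s)"
    using cong_add[OF that cong_refl[of 1]] by simp
  have down: "[m - 1 = x - 1] (mod int s)" if "[m = x] (mod int s)"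
    using cong_diff[OF that cong_refl[of 1]] by simp
  have not_up: "\<not> [m + 1 = x - 1] (mod int s)" if "[m = x - 1] (mod int s)"
    using up[OF that] not_cong_pred[OF assms, of x] cong_trans cong_sym by blast
  show ?thesis
    using up down not_up not_cong_pred[OF assms, of x]
    by (auto simp: affine_gen_class)
qed

text \<open>
  The generator at \<open>x\<close> moves only \<open>x - 1\<close> and \<open>x\<close> within the period that starts at \<open>x - 1\<close>, which
  makes this period the convenient one for summation. The condition \<open>s \<ge> 2\<close> keeps the two
  positions in different classes.
\<close>

lemma sum_window_split:
  fixes f :: "int \<Rightarrow> int"
  assumes "s \<ge> 2" and "\<And>m. f (m + int s) = f m"
  shows "(\<Sum>m\<in>{0..<int s}. f m) = f (x - 1) + f x + (\<Sum>m\<in>{x + 1..<x - 1 + int s}. f m)"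
proof -
  have "(\<Sum>m\<in>{0..<int s}. f m) = (\<Sum>m\<in>{x - 1..<x - 1 + int s}. f m)"
    using sum_transversal[OF transversal_window, of s f "x - 1"] assms by simp
  also have "{x - 1..<x - 1 + int s} = insert (x - 1) (insert x {x + 1..<x - 1 + int s})"
    using assms(1) by auto
  finally show ?thesis
    by simp
qed

lemma affine_gen_window:
  assumes "s \<ge> 2"
  shows "affine_gen s (cong_class s x) (x - 1) = x"
    and "affine_gen s (cong_class s x) x = x - 1"
    and "m \<in> {x + 1..<x - 1 + int s} \<Longrightarrow> affine_gen s (cong_class s x) m = m"
proof -
  show "affine_gen s (cong_class s x) (x - 1) = x" "affine_gen s (cong_class s x) x = x - 1"
    using not_cong_pred[OF assms, of x] by (simp_all add: affine_gen_class)
  assume m: "m \<in> {x + 1..<x - 1 + int s}"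
  have "\<not> int s dvd m - x" "\<not> int s dvd m - (x - 1)"
    using m by (auto dest: zdvd_imp_le)
  then show "affine_gen s (cong_class s x) m = m"
    by (simp add: affine_gen_class cong_iff_dvd_diff)
qed

lemma affine_gen_shift:
  "affine_gen s (cong_class s x) (m + int s) = affine_gen s (cong_class s x) m + int s"
proof -
  have "[m + int s = y] (mod int s) \<longleftrightarrow> [m = y] (mod int s)" for y
    by (simp add: cong_def)
  then show ?thesis
    by (simp add: affine_gen_class)
qed

lemma affine_gen_closed:
  assumes "s \<ge> 2"
  shows "affine_gen s (cong_class s x) \<in> carrier (affine_sym s)"
proof -
  let ?g = "affine_gen s (cong_class s x)"
  have "bij ?g"
    by (rule o_bij[where g = ?g]) (auto simp: affine_gen_involution[OF assms])
  moreover have "(\<Sum>m\<in>{0..<int s}. ?g m - m) = 0"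
    by (subst sum_window_split[OF assms, where x = x])
      (simp_all add: affine_gen_shift affine_gen_window[OF assms])
  ultimately show ?thesis
    by (simp add: affine_sym_iff affine_gen_shift)
qed

text \<open>
  The sum of squared displacements over a period serves as a termination measure for sorting: unlike
  the number of inversions it is visibly finite, and it changes in only two terms under a generator.
\<close>

definition energy :: "nat \<Rightarrow> (int \<Rightarrow> int) \<Rightarrow> int" where
  "energy s w = (\<Sum>m\<in>{0..<int s}. (w m - m)\<^sup>2)"

lemma energy_nonneg: "energy s w \<ge> 0"
  by (simp add: energy_def sum_nonneg)

text \<open>
  Exchanging the values \<open>p > q\<close> at the neighbouring positions \<open>x - 1\<close> and \<open>x\<close> changes the two
  squares so that the total drops by exactly \<open>2 * (p - q)\<close>.
\<close>

lemma energy_descent: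
  assumes s: "s \<ge> 2" and w: "w \<in> carrier (affine_sym s)" and less: "w x < w (x - 1)"
  shows "energy s (w \<circ> affine_gen s (cong_class s x)) < energy s w"
proof -
  let ?g = "affine_gen s (cong_class s x)"
  let ?rest = "\<Sum>m\<in>{x + 1..<x - 1 + int s}. (w m - m)\<^sup>2"
  have "energy s (w \<circ> ?g) = (w x - (x - 1))\<^sup>2 + (w (x - 1) - x)\<^sup>2 + ?rest"
    unfolding energy_def
    by (subst sum_window_split[OF s, where x = x])
      (simp_all add: affine_gen_shift affine_shift[OF w] affine_gen_window[OF s])
  moreover have "energy s w = (w (x - 1) - (x - 1))\<^sup>2 + (w x - x)\<^sup>2 + ?rest"
    unfolding energy_def
    by (subst sum_window_split[OF s, where x = x]) (simp_all add: affine_shift[OF w])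
  ultimately have "energy s w - energy s (w \<circ> ?g) = 2 * (w (x - 1) - w x)"
    by (simp add: power2_eq_square algebra_simps)
  then show ?thesis
    using less by simp
qed

text \<open>
  Without descents the displacement is weakly increasing; being periodic it is then constant, and a
  constant with sum \<open>0\<close> over a period vanishes.
\<close>

lemma no_descent_imp_id:
  assumes "s > 0" and w: "w \<in> carrier (affine_sym s)" and le: "\<And>x. w (x - 1) \<le> w x"
  shows "w = (\<lambda>x. x)"
proof
  fix m
  define d where "d = (\<lambda>m. w m - m)"
  have "w (x - 1) \<noteq> w x" for x
    using bij_is_inj[OF affine_bij[OF w]] by (simp add: inj_eq)
  then have "w (x - 1) < w x" for x
    using le[of x] by (simp add: order.strict_iff_order)
  then have step: "d (x - 1) \<le> d x" for x
    unfolding d_def by (smt (verit))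
  have up: "d x \<le> d (x + int j)" for x j
  proof (induction j)
    case (Suc j)
    then show ?case
      using step[of "x + int (Suc j)"] by simp
  qed simp
  have per: "d x = d y" if "[x = y] (mod int s)" for x y
    unfolding d_def using w that by (rule affine_displacement_cong)
  have const: "d x = d 0" for x
  proof (rule antisym)
    let ?r = "x mod int s"
    have r: "0 \<le> ?r" "?r < int s"
      using assms(1) by simp_all
    have x: "d x = d ?r"
      by (rule per) (simp add: cong_def)
    have "d ?r \<le> d (int s)"
      using up[of ?r "nat (int s - ?r)"] r by simp
    also have "d (int s) = d 0"
      by (rule per) (simp add: cong_def)
    finally show "d x \<le> d 0"
      using x by simp
    show "d 0 \<le> d x"
      using up[of 0 "nat ?r"] r x by simp
  qed
  have "int s * d 0 = (\<Sum>m\<in>{0..<int s}. d 0)"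
    by simp
  also have "\<dots> = (\<Sum>m\<in>{0..<int s}. d m)"
    by (rule sum.cong[OF refl]) (rule const[symmetric])
  also have "\<dots> = 0"
    using affine_sum_zero[OF w] by (simp add: d_def)
  finally have "d 0 = 0"
    using assms(1) by simp
  then show "w m = m"
    using const[of m] by (simp add: d_def)
qed

text \<open>
  The generators \<open>w\<^sub>i\<close> generate the affine symmetric group. The proof is sorting by adjacent
  exchanges: as long as there is a descent, a generator removes it and lowers the energy.
\<close>

lemma affine_sym_induct [consumes 2, case_names id gen]:
  assumes s: "s \<ge> 2" and w: "w \<in> carrier (affine_sym s)"
    and id: "P (\<lambda>x. x)"
    and gen: "\<And>w x. w \<in> carrier (affine_sym s) \<Longrightarrow> P w \<Longrightarrow> P (w \<circ> affine_gen s (cong_class s x))"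
  shows "P w"
  using w
proof (induction "nat (energy s w)" arbitrary: w rule: less_induct)
  case less
  show ?case
  proof (cases "\<exists>x. w x < w (x - 1)")
    case True
    then obtain x where x: "w x < w (x - 1)"
      by blast
    let ?g = "affine_gen s (cong_class s x)"
    have closed: "w \<circ> ?g \<in> carrier (affine_sym s)"
      using s less.prems by (simp add: affine_comp_closed affine_gen_closed)
    moreover have "nat (energy s (w \<circ> ?g)) < nat (energy s w)"
      using energy_descent[OF s less.prems x] energy_nonneg[of s "w \<circ> ?g"] by linarith
    ultimately have "P (w \<circ> ?g)"
      by (rule less.hyps[rotated])
    then have "P ((w \<circ> ?g) \<circ> ?g)"
      by (rule gen[OF closed])
    moreover have "(w \<circ> ?g) \<circ> ?g = w"
      by (simp add: fun_eq_iff affine_gen_involution[OF s])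
    ultimately show ?thesis
      by simp
  next
    case False
    then have "w = (\<lambda>x. x)"
      using s less.prems by (intro no_descent_imp_id) (auto simp: not_less)
    then show ?thesis
      using id by simp
  qed
qed

lemma action_id:
  assumes "group_action (affine_sym s) UNIV \<phi>"
  shows "\<phi> (\<lambda>x. x) = (\<lambda>x. x)"
proof -
  have "\<one>\<^bsub>affine_sym s\<^esub> = (\<lambda>x. x)" "\<one>\<^bsub>BijGroup UNIV\<^esub> = (\<lambda>x. x)"
    by (simp_all add: affine_sym_def BijGroup_def restrict_def)
  then show ?thesis
    using group_hom.hom_one[OF group_action.group_hom[OF assms]] by simp
qed

lemma action_comp:
  assumes "group_action (affine_sym s) UNIV \<phi>"
    and "v \<in> carrier (affine_sym s)" "w \<in> carrier (affine_sym s)"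
  shows "\<phi> (v \<circ> w) = \<phi> v \<circ> \<phi> w"
proof -
  interpret group_hom "affine_sym s" "BijGroup UNIV" \<phi>
    by (rule group_action.group_hom[OF assms(1)])
  show ?thesis
    using hom_mult[OF assms(2,3)] hom_closed[OF assms(2)] hom_closed[OF assms(3)]
    by (simp add: affine_mult[OF assms(2,3)] mult_BijGroup_UNIV)
qed

lemma action_determined_by_generators:
  assumes s: "s \<ge> 2"
    and phi: "group_action (affine_sym s) UNIV \<phi>" and psi: "group_action (affine_sym s) UNIV \<psi>"
    and gens: "\<And>x. \<phi> (affine_gen s (cong_class s x)) = \<psi> (affine_gen s (cong_class s x))"
    and w: "w \<in> carrier (affine_sym s)"
  shows "\<phi> w = \<psi> w"
  using s w
proof (induction rule: affine_sym_induct)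
  case id
  show ?case
    by (simp add: action_id[OF phi] action_id[OF psi])
next
  case (gen w x)
  then show ?case
    by (simp only: action_comp[OF phi] action_comp[OF psi] affine_gen_closed[OF s] gens)
qed

section \<open>An explicit formula for the level action\<close>

locale coprime_level =
  fixes s t :: nat
  assumes s2: "s \<ge> 2" and t1: "t \<ge> 1" and coprime_st: "coprime s t"
begin

text \<open>
  The index of \<open>m\<close> is an integer \<open>k\<close> with \<open>m \<in> k t - s \<circ> t\<close> modulo \<open>s\<close>. It is determined only
  modulo \<open>s\<close>, which is harmless because only the displacement of an affine permutation at the
  index is ever used.
\<close>

definition index :: "int \<Rightarrow> int" where
  "index m = (SOME k. [k * int t = m + circ s t] (mod int s))"

lemma index_cong: "[index m * int t = m + circ s t] (mod int s)"
proof -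
  have "coprime (int t) (int s)"
    using coprime_st by (simp add: coprime_commute)
  then obtain u where "[int t * u = 1] (mod int s)"
    using cong_solve_coprime_int by blast
  from cong_scalar_right[OF this, of "m + circ s t"]
  have "[(u * (m + circ s t)) * int t = m + circ s t] (mod int s)"
    by (simp add: ac_simps)
  then show ?thesis
    unfolding index_def by (rule someI)
qed

lemma index_cong_iff: "[index m = k] (mod int s) \<longleftrightarrow> [m = k * int t - circ s t] (mod int s)"
proof -
  have "coprime (int t) (int s)"
    using coprime_st by (simp add: coprime_commute)
  then have "[index m = k] (mod int s) \<longleftrightarrow> [index m * int t = k * int t] (mod int s)"
    by (simp add: cong_mult_rcancel)
  also have "\<dots> \<longleftrightarrow> [m + circ s t = k * int t] (mod int s)"
    using index_cong[of m] cong_trans cong_sym by blast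
  also have "\<dots> \<longleftrightarrow> [m = k * int t - circ s t] (mod int s)"
    by (simp add: cong_iff_dvd_diff algebra_simps)
  finally show ?thesis .
qed

text \<open>
  On generators, \<open>m\<close> moves by \<open>t\<close> times the amount by which the generator moves the index of \<open>m\<close>.
  The same recipe for an arbitrary \<open>w\<close> is compatible with composition, because the
  class that \<open>m\<close> moves to has index \<open>w k\<close> when \<open>m\<close> has index \<open>k\<close>.
\<close>

definition level_perm :: "(int \<Rightarrow> int) \<Rightarrow> int \<Rightarrow> int" where
  "level_perm w m = m + int t * (w (index m) - index m)"

lemma level_perm_cong:
  assumes w: "w \<in> carrier (affine_sym s)" and k: "[m = k * int t - circ s t] (mod int s)"
  shows "level_perm w m = m + int t * (w k - k)"
proof -
  have "[index m = k] (mod int s)"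
    using k by (simp add: index_cong_iff)
  then have "w (index m) - index m = w k - k"
    by (rule affine_displacement_cong[OF w])
  then show ?thesis
    by (simp add: level_perm_def)
qed

lemma index_self: "[m = index m * int t - circ s t] (mod int s)"
  using index_cong_iff[of m "index m"] by simp

lemma level_perm_shift:
  assumes w: "w \<in> carrier (affine_sym s)"
  shows "level_perm w (m + int s) = level_perm w m + int s"
proof -
  have "[m + int s = index m * int t - circ s t] (mod int s)"
    using index_self[of m] by (simp add: cong_def)
  from level_perm_cong[OF w this] show ?thesis
    by (simp add: level_perm_def)
qed

lemma level_perm_comp:
  assumes v: "v \<in> carrier (affine_sym s)" and w: "w \<in> carrier (affine_sym s)"
  shows "level_perm (v \<circ> w) = level_perm v \<circ> level_perm w"
proof
  fix m
  let ?k = "index m"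
  have "[level_perm w m = w ?k * int t - circ s t] (mod int s)"
    using cong_add[OF index_self[of m] cong_refl[of "int t * (w ?k - ?k)"]]
    by (simp add: level_perm_def algebra_simps)
  from level_perm_cong[OF v this]
  show "level_perm (v \<circ> w) m = (level_perm v \<circ> level_perm w) m"
    by (simp add: level_perm_def algebra_simps)
qed

lemma level_perm_id: "level_perm (\<lambda>x. x) = (\<lambda>x. x)"
  by (simp add: level_perm_def fun_eq_iff)

lemma bij_level_perm:
  assumes w: "w \<in> carrier (affine_sym s)"
  shows "bij (level_perm w)"
proof (rule o_bij)
  let ?v = "inv_into UNIV w"
  have v: "?v \<in> carrier (affine_sym s)"
    using s2 w by (simp add: affine_inv_closed)
  have "?v \<circ> w = (\<lambda>x. x)" "w \<circ> ?v = (\<lambda>x. x)"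
    using affine_bij[OF w] by (auto simp: fun_eq_iff bij_is_inj bij_is_surj surj_f_inv_f)
  then show "level_perm ?v \<circ> level_perm w = id" "level_perm w \<circ> level_perm ?v = id"
    using level_perm_comp[OF v w] level_perm_comp[OF w v] level_perm_id by (simp_all add: id_def)
qed

lemma level_perm_gen:
  "level_perm (affine_gen s (cong_class s x)) = level_gen s t (cong_class s x)"
  by (auto simp: fun_eq_iff level_perm_def level_gen_class affine_gen_class index_cong_iff)

lemma level_perm_action:
  "group_action (affine_sym s) UNIV (restrict level_perm (carrier (affine_sym s)))"
proof -
  have G: "group (affine_sym s)"
    using s2 by (simp add: group_affine_sym)
  have closed: "v \<circ> w \<in> carrier (affine_sym s)"
    if "v \<in> carrier (affine_sym s)" "w \<in> carrier (affine_sym s)" for v w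
    using s2 that by (simp add: affine_comp_closed)
  have "restrict level_perm (carrier (affine_sym s)) \<in> hom (affine_sym s) (BijGroup UNIV)"
    by (rule homI) (simp_all add: carrier_BijGroup_UNIV bij_level_perm affine_mult
        mult_BijGroup_UNIV closed level_perm_comp)
  then show ?thesis
    unfolding group_action_def group_hom_def group_hom_axioms_def
    using G group_BijGroup by blast
qed

text \<open>
  The explicit formula shows that an action with the prescribed values on the generators exists, and
  generation shows that there is only one, so the definite description is justified.
\<close>

lemma level_action_eq:
  assumes w: "w \<in> carrier (affine_sym s)"
  shows "level_action s t w = level_perm w"
proof -
  let ?C = "carrier (affine_sym s)"
  have "level_action s t = restrict level_perm ?C"
    unfolding level_action_def
  proof (rule the_equality)
    show "restrict level_perm ?C \<in> extensional ?C \<and>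
      group_action (affine_sym s) UNIV (restrict level_perm ?C) \<and>
      (\<forall>i\<in>residue_classes s. restrict level_perm ?C (affine_gen s i) = level_gen s t i)"
      using s2 level_perm_action
      by (auto simp: residue_classes_eq affine_gen_closed level_perm_gen)
  next
    fix \<phi>
    assume phi: "\<phi> \<in> extensional ?C \<and> group_action (affine_sym s) UNIV \<phi> \<and>
      (\<forall>i\<in>residue_classes s. \<phi> (affine_gen s i) = level_gen s t i)"
    show "\<phi> = restrict level_perm ?C"
    proof (rule extensionalityI)
      fix v assume v: "v \<in> ?C"
      show "\<phi> v = restrict level_perm ?C v"
        by (rule action_determined_by_generators[OF s2 _ level_perm_action _ v])
          (use s2 phi in \<open>auto simp: residue_classes_eq affine_gen_closed level_perm_gen\<close>)
    qed (use phi in auto)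
  qed
  then show ?thesis
    using w by simp
qed

end

section \<open>Partitions and their beta-sets\<close>

definition beta :: "(nat \<Rightarrow> nat) \<Rightarrow> nat \<Rightarrow> int" where
  "beta lam i = int (lam i) - int i"

lemma beta_set_image: "beta_set lam = beta lam ` {1..}"
  by (auto simp: beta_set_def beta_def)

lemma partition_antimono:
  "is_partition lam \<Longrightarrow> 1 \<le> i \<Longrightarrow> i \<le> j \<Longrightarrow> lam j \<le> lam i"
  unfolding is_partition_def monotone_on_def by auto

lemma beta_less_iff:
  assumes "is_partition lam" "1 \<le> i" "1 \<le> j"
  shows "beta lam j < beta lam i \<longleftrightarrow> i < j"
proof -
  have "beta lam j < beta lam i" if "1 \<le> i" "i < j" for i j
    using partition_antimono[OF assms(1), of i j] that by (simp add: beta_def)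
  then show ?thesis
    using assms(2,3) by (metis less_asym linorder_neqE_nat less_irrefl)
qed

text \<open>
  A partition can be read off from its beta-set, because the number of larger elements reveals the
  position of an element.
\<close>

lemma beta_rank:
  assumes "is_partition lam" "1 \<le> i"
  shows "card {x \<in> beta_set lam. beta lam i < x} = i - 1"
proof -
  have "{x \<in> beta_set lam. beta lam i < x} = beta lam ` {1..<i}"
    using beta_less_iff[OF assms(1) _ assms(2)] by (auto simp: beta_set_image)
  moreover have "inj_on (beta lam) {1..<i}"
  proof (rule inj_onI)
    fix j k assume "j \<in> {1..<i}" "k \<in> {1..<i}" "beta lam j = beta lam k"
    then show "j = k"
      using beta_less_iff[OF assms(1), of j k] beta_less_iff[OF assms(1), of k j] by simp
  qed
  ultimately show ?thesis
    by (simp add: card_image)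
qed

lemma beta_set_inject:
  assumes lam: "is_partition lam" and mu: "is_partition mu" and eq: "beta_set lam = beta_set mu"
  shows "lam = mu"
proof (rule extensionalityI)
  show "lam \<in> extensional {1..}" "mu \<in> extensional {1..}"
    using lam mu by (simp_all add: is_partition_def)
  fix i :: nat assume "i \<in> {1..}"
  then have i: "1 \<le> i" by simp
  have "beta lam i \<in> beta_set mu"
    using i eq[symmetric] by (auto simp: beta_set_image)
  then obtain j where j: "1 \<le> j" "beta lam i = beta mu j"
    by (auto simp: beta_set_image)
  then have "i = j"
    using beta_rank[OF lam i] beta_rank[OF mu j(1)] eq i by simp
  then show "lam i = mu i"
    using j by (simp add: beta_def)
qed

text \<open>
  A set of integers that contains all small integers and is bounded above has a charge, the excess
  over the beta-set of the empty partition. Charge \<open>0\<close> is expressed by counting the elements from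
  \<open>- N\<close> on for a sufficiently small cutoff \<open>- N\<close>.
\<close>

definition charge_free :: "int set \<Rightarrow> nat \<Rightarrow> bool" where
  "charge_free B N \<longleftrightarrow>
     (\<forall>x < - int N. x \<in> B) \<and> finite (B \<inter> {- int N..}) \<and> card (B \<inter> {- int N..}) = N"

lemma charge_free_mono:
  assumes "charge_free B N" "N \<le> M"
  shows "charge_free B M"
proof -
  have eq: "B \<inter> {- int M..} = (B \<inter> {- int N..}) \<union> {- int M..<- int N}"
    using assms by (auto simp: charge_free_def)
  have "card (B \<inter> {- int M..}) = N + (M - N)"
    unfolding eq using assms by (subst card_Un_disjoint) (auto simp: charge_free_def)
  then show ?thesis
    using assms eq by (auto simp: charge_free_def)
qed

lemma charge_free_beta_set:
  assumes "is_partition lam"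
  shows "\<exists>N. charge_free (beta_set lam) N"
proof -
  obtain N where N: "\<And>i. N \<le> i \<Longrightarrow> lam i = 0"
    using assms unfolding is_partition_def eventually_sequentially by blast
  have "x \<in> beta_set lam" if "x < - int N" for x
  proof -
    have "x = beta lam (nat (- x))"
      using that N[of "nat (- x)"] by (simp add: beta_def)
    then show ?thesis
      using that by (auto simp: beta_set_image)
  qed
  moreover have eq: "beta_set lam \<inter> {- int N..} = beta lam ` {1..N}"
  proof -
    have "i \<le> N" if "beta lam i \<ge> - int N" for i
      using that N[of i] by (cases "i \<le> N") (simp_all add: beta_def)
    moreover have "beta lam i \<ge> - int N" if "i \<le> N" for i
      using that by (simp add: beta_def)
    ultimately show ?thesis
      by (auto simp: beta_set_image)
  qed
  moreover have "inj_on (beta lam) {1..N}"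
  proof (rule inj_onI)
    fix j k assume "j \<in> {1..N}" "k \<in> {1..N}" "beta lam j = beta lam k"
    then show "j = k"
      using beta_less_iff[OF assms, of j k] beta_less_iff[OF assms, of k j] by simp
  qed
  ultimately have "charge_free (beta_set lam) N"
    by (simp add: charge_free_def card_image)
  then show ?thesis ..
qed

text \<open>
  The parts are recovered by listing the elements from the cutoff on in decreasing order, which is
  why the ascending list is indexed by \<open>N - i\<close>. Since there are exactly \<open>N\<close> of them and they are
  distinct, the \<open>i\<close>-th largest is at least \<open>- i\<close>, so that no part is negative.
\<close>

lemma partition_of_charge_free:
  assumes "charge_free B N"
  shows "\<exists>lam. is_partition lam \<and> beta_set lam = B"
proof -
  define F where "F = B \<inter> {- int N..}"
  define ys where "ys = sorted_list_of_set F"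
  have F: "finite F" "card F = N" and low: "\<And>x. x < - int N \<Longrightarrow> x \<in> B"
    using assms by (auto simp: charge_free_def F_def)
  have len: "length ys = N" and set: "set ys = F"
    using F by (simp_all add: ys_def)
  have less: "ys ! k < ys ! l" if "k < l" "l < N" for k l
    using sorted_wrt_nth_less[of "(<)" ys k l] that len by (simp add: ys_def)
  have gap: "ys ! k + int d \<le> ys ! (k + d)" if "k + d < N" for k d
    using that
  proof (induction d)
    case (Suc d)
    then show ?case
      using less[of "k + d" "k + Suc d"] by simp
  qed simp
  have ge: "- int N + int k \<le> ys ! k" if "k < N" for k
  proof -
    have "ys ! 0 \<in> F"
      using that len set nth_mem[of 0 ys] by simp
    then show ?thesis
      using gap[of 0 k] that by (simp add: F_def)
  qed
  define lam where
    "lam = (\<lambda>i\<in>{1..}. if i \<le> N then nat (ys ! (N - i) + int i) else 0)"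
  have lam_in: "int (lam i) = ys ! (N - i) + int i" if "1 \<le> i" "i \<le> N" for i
    using ge[of "N - i"] that by (simp add: lam_def of_nat_diff)
  have lam_out: "lam i = 0" if "N < i" for i
    using that by (simp add: lam_def)
  have "lam j \<le> lam i" if "1 \<le> i" "i \<le> j" for i j
  proof (cases "j \<le> N")
    case True
    have "ys ! (N - j) + int (j - i) \<le> ys ! (N - j + (j - i))"
      using that True by (intro gap) simp
    moreover have "N - j + (j - i) = N - i"
      using that True by simp
    ultimately have "int (lam j) \<le> int (lam i)"
      using that True by (simp add: lam_in of_nat_diff)
    then show ?thesis by simp
  qed (simp add: lam_out)
  then have "is_partition lam"
    unfolding is_partition_def eventually_sequentially monotone_on_def
    using lam_out by (auto simp: lam_def intro!: exI[of _ "Suc N"])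
  moreover have "beta_set lam = B"
  proof (intro equalityI subsetI)
    fix x assume "x \<in> beta_set lam"
    then obtain i where i: "1 \<le> i" "x = beta lam i"
      by (auto simp: beta_set_image)
    show "x \<in> B"
    proof (cases "i \<le> N")
      case True
      then have "x = ys ! (N - i)"
        using i by (simp add: beta_def lam_in)
      then have "x \<in> F"
        using i True len set nth_mem[of "N - i" ys] by simp
      then show ?thesis
        by (simp add: F_def)
    next
      case False
      then show ?thesis
        using i by (intro low) (simp add: beta_def lam_out)
    qed
  next
    fix x assume x: "x \<in> B"
    show "x \<in> beta_set lam"
    proof (cases "x < - int N")
      case True
      then have "x = beta lam (nat (- x))"
        by (simp add: beta_def lam_out)
      then show ?thesis
        using True by (auto simp: beta_set_image)
    next
      case False
      then have "x \<in> set ys"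
        using x set by (simp add: F_def)
      then obtain k where k: "k < N" "x = ys ! k"
        using len by (auto simp: in_set_conv_nth)
      then have "x = beta lam (N - k)"
        by (simp add: beta_def lam_in)
      moreover have "N - k \<in> {1..}"
        using k by simp
      ultimately show ?thesis
        by (auto simp: beta_set_image)
    qed
  qed
  ultimately show ?thesis by blast
qed

text \<open>
  The integers outside the beta-set are the numbers \<open>c - 1 - \<lambda>'\<^sub>c\<close>. Given such an integer \<open>x\<close>, the
  column \<open>c\<close> is found from the first row \<open>k\<close> whose beta-number lies below \<open>x\<close>: exactly the rows
  before \<open>k\<close> reach column \<open>x + k\<close>.
\<close>

lemma not_in_beta_set:
  assumes lam: "is_partition lam" and x: "x \<notin> beta_set lam"
  shows "\<exists>c\<ge>1. x = int c - 1 - int (conjugate lam c) \<and> (\<forall>i\<ge>1. c \<le> lam i \<longleftrightarrow> x < beta lam i)"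
proof -
  obtain N where N: "\<And>i. N \<le> i \<Longrightarrow> lam i = 0"
    using lam unfolding is_partition_def eventually_sequentially by blast
  define P where "P = (\<lambda>i. 1 \<le> i \<and> beta lam i < x)"
  \<comment> \<open>a row of length \<open>0\<close> that lies beyond \<open>- x\<close>\<close>
  have "beta lam (Suc (max N (nat (- x)))) < x"
    by (simp add: beta_def N)
  then have ex: "P (Suc (max N (nat (- x))))"
    by (simp add: P_def)
  define k where "k = (LEAST i. P i)"
  have k: "1 \<le> k" "beta lam k < x"
    using LeastI[of P, OF ex] by (simp_all add: P_def k_def)
  have above: "x < beta lam i" if "1 \<le> i" "i < k" for i
  proof -
    have "\<not> P i"
      using that not_less_Least unfolding k_def by blast
    moreover have "beta lam i \<noteq> x"
      using x that by (auto simp: beta_set_image)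
    ultimately show ?thesis
      using that by (simp add: P_def)
  qed
  have iff: "x < beta lam i \<longleftrightarrow> i < k" if "1 \<le> i" for i
    using above[OF that] beta_less_iff[OF lam k(1) that] k(2)
    by (metis less_asym linorder_neqE_nat less_trans)
  define c where "c = nat (x + int k)"
  have c: "int c = x + int k" "1 \<le> c"
    using k by (simp_all add: c_def beta_def)
  have le_iff: "c \<le> lam i \<longleftrightarrow> x < beta lam i" if "1 \<le> i" for i
  proof (cases "i < k")
    case True
    have "lam (k - 1) \<le> lam i"
      using True that by (intro partition_antimono[OF lam]) simp_all
    moreover have "x < beta lam (k - 1)"
      using True that by (intro above) simp_all
    ultimately have "c \<le> lam i"
      using c(1) True by (simp add: beta_def of_nat_diff)
    then show ?thesis
      using iff[OF that] True by simp
  next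
    case False
    then have "lam i \<le> lam k"
      using k(1) by (intro partition_antimono[OF lam]) simp_all
    then have "\<not> c \<le> lam i"
      using c(1) k(2) by (simp add: beta_def)
    then show ?thesis
      using iff[OF that] False by simp
  qed
  have "{j. 1 \<le> j \<and> c \<le> lam j} = {1..<k}"
    using le_iff iff by auto
  then have "conjugate lam c = k - 1"
    by (simp add: conjugate_def)
  then have "x = int c - 1 - int (conjugate lam c)"
    using c(1) k(1) by (simp add: of_nat_diff)
  then show ?thesis
    using c(2) le_iff by blast
qed

text \<open>
  The hook lengths in row \<open>r\<close> are the differences between the \<open>r\<close>-th beta-number and the smaller
  integers outside the beta-set. So a beta-number \<open>b\<close> with \<open>b - s\<close> missing would produce a hook of
  length \<open>s\<close>.
\<close>

lemma core_beta_set_closed: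
  assumes "lam \<in> cores s" "s > 0" "b \<in> beta_set lam"
  shows "b - int s \<in> beta_set lam"
proof (rule ccontr)
  have lam: "is_partition lam"
    using assms(1) by (simp add: cores_def)
  assume "b - int s \<notin> beta_set lam"
  then obtain c where c: "1 \<le> c" "b - int s = int c - 1 - int (conjugate lam c)"
    "\<And>i. 1 \<le> i \<Longrightarrow> c \<le> lam i \<longleftrightarrow> b - int s < beta lam i"
    using not_in_beta_set[OF lam] by blast
  obtain r where r: "1 \<le> r" "b = beta lam r"
    using assms(3) by (auto simp: beta_set_image)
  have "c \<le> lam r"
    using c(3)[OF r(1)] r(2) assms(2) by simp
  moreover have "hook_length lam r c = int s"
    using c(2) r(2) by (simp add: hook_length_def beta_def)
  ultimately show False
    using assms(1) r(1) c(1) by (simp add: cores_def)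
qed

section \<open>Abaci of s-cores\<close>

text \<open>
  For a set closed under subtraction of \<open>s\<close>, the frontier collects the first missing integer of each
  class; for the beta-set of an \<open>s\<close>-core it is the \<open>s\<close>-set. The abacus rebuilds the set from its
  frontier. Both constructions commute with bijections that commute with the shift by \<open>s\<close>, so a
  condition on a beta-set turns into a condition on finitely many integers.
\<close>

definition frontier :: "nat \<Rightarrow> int set \<Rightarrow> int set" where
  "frontier s B = {a. a \<notin> B \<and> a - int s \<in> B}"

definition abacus :: "nat \<Rightarrow> int set \<Rightarrow> int set" where
  "abacus s A = {a - int s * int j | a j. a \<in> A \<and> 1 \<le> j}"

lemma closed_iterate:
  assumes "\<forall>b\<in>B. b - int s \<in> B" "b \<in> B"
  shows "b - int s * int j \<in> B"
proof (induction j)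
  case (Suc j)
  then have "(b - int s * int j) - int s \<in> B"
    using assms(1) by blast
  then show ?case
    by (simp add: algebra_simps)
qed (use assms(2) in simp)

lemma cong_less_imp:
  assumes "[x = y] (mod int s)" "x < y"
  shows "\<exists>j\<ge>1. x = y - int s * int j"
proof -
  obtain k where k: "y = x + int s * k"
    using assms(1) by (auto simp: cong_iff_lin)
  then have "int s * k > 0"
    using assms(2) by simp
  then have "k > 0"
    by (simp add: zero_less_mult_iff)
  then show ?thesis
    using k by (intro exI[of _ "nat k"]) simp
qed

lemma frontier_le:
  assumes closed: "\<forall>b\<in>B. b - int s \<in> B"
    and "a \<in> frontier s B" "[y = a] (mod int s)" "y \<notin> B"
  shows "a \<le> y"
proof (rule ccontr)
  assume "\<not> a \<le> y"
  then obtain j where j: "1 \<le> j" "y = a - int s * int j"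
    using cong_less_imp[OF assms(3)] by (auto simp: not_le)
  have "(a - int s) - int s * int (j - 1) \<in> B"
    using assms(2) by (intro closed_iterate[OF closed]) (simp add: frontier_def)
  moreover have "(a - int s) - int s * int (j - 1) = y"
    using j by (simp add: of_nat_diff algebra_simps)
  ultimately show False
    using assms(4) by simp
qed

text \<open>
  Climb in steps of \<open>s\<close> from a member of the class that is so small that it lies in \<open>B\<close>. As \<open>B\<close>
  has only finitely many elements above the cutoff, the climb leaves \<open>B\<close>, and the first
  integer outside \<open>B\<close> is in the frontier.
\<close>

lemma frontier_ex:
  assumes "s > 0" and B: "charge_free B N"
  shows "\<exists>a\<in>frontier s B. [a = m] (mod int s)"
proof -
  define r where "r = m mod int s"
  have r: "0 \<le> r" "r < int s"
    using assms(1) by (simp_all add: r_def)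
  \<comment> \<open>low enough in the class of \<open>m\<close> to lie below the cutoff\<close>
  define lo where "lo = r - int s * int (N + 1)"
  have "int s * int N \<ge> int N"
    using assms(1) by (simp add: mult_le_cancel_right1)
  then have lo: "lo < - int N"
    using r by (simp add: lo_def algebra_simps)
  define P where "P = (\<lambda>j. lo + int s * int j \<notin> B)"
  have fin: "finite (B \<inter> {- int N..})"
    using B by (simp add: charge_free_def)
  have "\<exists>j. P j"
  proof (rule ccontr)
    assume "\<nexists>j. P j"
    then have "lo + int s * int (j + (N + 1)) \<in> B" for j
      unfolding P_def by blast
    moreover have "lo + int s * int (j + (N + 1)) = r + int s * int j" for j
      by (simp add: lo_def algebra_simps)
    moreover have "- int N \<le> r + int s * int j" for j
    proof -
      have "0 \<le> int s * int j" by simp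
      then show ?thesis using r by linarith
    qed
    ultimately have *: "range (\<lambda>j. r + int s * int j) \<subseteq> B \<inter> {- int N..}"
      by auto
    have "inj (\<lambda>j. r + int s * int j)"
      using assms(1) by (auto simp: inj_def)
    then show False
      using finite_subset[OF * fin] finite_imageD by blast
  qed
  define j where "j = (LEAST j. P j)"
  have j: "P j"
    using \<open>\<exists>j. P j\<close> unfolding j_def by (rule LeastI_ex)
  have "\<not> P 0"
    using lo B by (simp add: P_def charge_free_def)
  then have "j \<noteq> 0"
    using j by metis
  then have "\<not> P (j - 1)"
    using not_less_Least[of "j - 1" P] by (simp add: j_def)
  then have "lo + int s * int j - int s \<in> B"
    using \<open>j \<noteq> 0\<close> by (simp add: P_def of_nat_diff algebra_simps)
  then have "lo + int s * int j \<in> frontier s B"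
    using j by (simp add: P_def frontier_def)
  moreover have "[lo + int s * int j = m] (mod int s)"
  proof -
    have "r = m - int s * (m div int s)"
      by (simp add: r_def minus_mult_div_eq_mod)
    then have "lo + int s * int j - m = int s * (int j - int (N + 1) - m div int s)"
      by (simp add: lo_def algebra_simps)
    then show ?thesis
      unfolding cong_iff_dvd_diff by (rule dvdI)
  qed
  ultimately show ?thesis by blast
qed

lemma transversal_frontier:
  assumes "s > 0" and "charge_free B N" and closed: "\<forall>b\<in>B. b - int s \<in> B"
  shows "transversal s (frontier s B)"
proof (rule transversalI[OF assms(1)])
  fix a b assume ab: "a \<in> frontier s B" "b \<in> frontier s B" "[a = b] (mod int s)"
  then have "a \<notin> B" "b \<notin> B"
    by (simp_all add: frontier_def)
  then show "a = b"
    using frontier_le[OF closed ab(1) cong_sym[OF ab(3)]] frontier_le[OF closed ab(2,3)]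
    by simp
qed (rule frontier_ex[OF assms(1,2)])

lemma abacus_frontier:
  assumes "s > 0" and "charge_free B N" and closed: "\<forall>b\<in>B. b - int s \<in> B"
  shows "abacus s (frontier s B) = B"
proof (intro equalityI subsetI)
  fix x assume "x \<in> abacus s (frontier s B)"
  then obtain a j where aj: "a \<in> frontier s B" "1 \<le> j" "x = a - int s * int j"
    by (auto simp: abacus_def)
  then have "(a - int s) - int s * int (j - 1) \<in> B"
    by (intro closed_iterate[OF closed]) (simp add: frontier_def)
  moreover have "(a - int s) - int s * int (j - 1) = x"
    using aj by (simp add: of_nat_diff algebra_simps)
  ultimately show "x \<in> B"
    by simp
next
  fix x assume x: "x \<in> B"
  obtain a where a: "a \<in> frontier s B" "[a = x] (mod int s)"
    using frontier_ex[OF assms(1,2)] by blast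
  have "x < a"
  proof (rule ccontr)
    assume "\<not> x < a"
    moreover have "x \<noteq> a"
      using a x by (auto simp: frontier_def)
    ultimately have "a < x" by simp
    then obtain j where "1 \<le> j" "a = x - int s * int j"
      using cong_less_imp[OF a(2)] by blast
    then show False
      using closed_iterate[OF closed x] a(1) by (simp add: frontier_def)
  qed
  then obtain j where "1 \<le> j" "x = a - int s * int j"
    using cong_less_imp[OF cong_sym[OF a(2)]] by blast
  then show "x \<in> abacus s (frontier s B)"
    using a(1) by (auto simp: abacus_def)
qed

lemma frontier_abacus:
  assumes "s > 0" "transversal s A"
  shows "frontier s (abacus s A) = A"
proof (intro equalityI subsetI)
  fix x assume "x \<in> frontier s (abacus s A)"
  then have x: "x \<notin> abacus s A" "x - int s \<in> abacus s A"
    by (simp_all add: frontier_def)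
  then obtain a j where aj: "a \<in> A" "1 \<le> j" "x - int s = a - int s * int j"
    by (auto simp: abacus_def)
  have "j = 1"
  proof (rule ccontr)
    assume "j \<noteq> 1"
    then have "1 \<le> j - 1" "x = a - int s * int (j - 1)"
      using aj by (simp_all add: of_nat_diff algebra_simps)
    then show False
      using x(1) aj(1) unfolding abacus_def by blast
  qed
  then show "x \<in> A"
    using aj by simp
next
  fix a assume a: "a \<in> A"
  have "a - int s \<in> abacus s A"
    unfolding abacus_def using a by (auto intro!: exI[of _ a] exI[of _ "1::nat"])
  moreover have "a \<notin> abacus s A"
  proof
    assume "a \<in> abacus s A"
    then obtain b j where bj: "b \<in> A" "1 \<le> j" "a = b - int s * int j"
      by (auto simp: abacus_def)
    have "[b = a] (mod int s)"
      by (simp add: bj(3) cong_iff_dvd_diff)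
    then have "b = a"
      using transversal_unique[OF assms(2)] a bj(1) by blast
    then show False
      using bj assms(1) by simp
  qed
  ultimately show "a \<in> frontier s (abacus s A)"
    by (simp add: frontier_def)
qed

text \<open>
  With cutoff \<open>- s M\<close>, the class of \<open>a\<close> contributes \<open>a div s + M\<close> elements. The total is \<open>s M\<close> iff
  the quotients \<open>a div s\<close> add up to \<open>0\<close>, and as the remainders run through \<open>0, \<dots>, s - 1\<close>, this
  is a condition on the sum of \<open>A\<close> alone.
\<close>

lemma charge_free_abacus_iff:
  assumes s: "s > 0" and A: "transversal s A" and low: "\<And>a. a \<in> A \<Longrightarrow> - int (s * M) \<le> a"
  shows "charge_free (abacus s A) (s * M) \<longleftrightarrow> (\<Sum>a\<in>A. a) = (\<Sum>r\<in>{0..<int s}. r)"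
proof -
  define h where "h = (\<lambda>a. nat (a div int s + int M))"
  define runner where "runner = (\<lambda>a. (\<lambda>j. a - int s * int j) ` {1..h a})"
  have le_iff_div: "- int (s * M) \<le> a - int s * int j \<longleftrightarrow> int j \<le> a div int s + int M" for a j
  proof -
    have "- int (s * M) \<le> a - int s * int j \<longleftrightarrow> 0 \<le> a + (int M - int j) * int s"
      by (simp add: algebra_simps)
    also have "\<dots> \<longleftrightarrow> 0 \<le> (a + (int M - int j) * int s) div int s"
      using s by (intro pos_imp_zdiv_nonneg_iff[symmetric]) simp
    also have "\<dots> \<longleftrightarrow> 0 \<le> (int M - int j) + a div int s"
      using s by (subst div_mult_self1) simp_all
    finally show ?thesis by linarith
  qed
  have nonneg: "a div int s + int M \<ge> 0" if "a \<in> A" for a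
    using low[OF that] le_iff_div[of a 0] by simp
  have le_iff: "- int (s * M) \<le> a - int s * int j \<longleftrightarrow> j \<le> h a" if "a \<in> A" for a j
    unfolding le_iff_div using nonneg[OF that] by (simp add: h_def le_nat_iff)
  have eq: "abacus s A \<inter> {- int (s * M)..} = (\<Union>a\<in>A. runner a)"
  proof (intro equalityI subsetI)
    fix x assume "x \<in> abacus s A \<inter> {- int (s * M)..}"
    then obtain a j where aj: "a \<in> A" "1 \<le> j" "x = a - int s * int j" "- int (s * M) \<le> x"
      unfolding abacus_def by blast
    then have "j \<in> {1..h a}"
      using le_iff[OF aj(1), of j] by simp
    then show "x \<in> (\<Union>a\<in>A. runner a)"
      unfolding runner_def using aj by blast
  next
    fix x assume "x \<in> (\<Union>a\<in>A. runner a)"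
    then obtain a j where aj: "a \<in> A" "j \<in> {1..h a}" "x = a - int s * int j"
      unfolding runner_def by blast
    then have "- int (s * M) \<le> x" "1 \<le> j"
      using le_iff[OF aj(1), of j] by simp_all
    then show "x \<in> abacus s A \<inter> {- int (s * M)..}"
      unfolding abacus_def using aj by blast
  qed
  have disj: "runner a \<inter> runner b = {}" if "a \<in> A" "b \<in> A" "a \<noteq> b" for a b
  proof (rule ccontr)
    assume "runner a \<inter> runner b \<noteq> {}"
    then obtain j k where "a - int s * int j = b - int s * int k"
      by (auto simp: runner_def)
    then have "b = a + int s * (int k - int j)"
      by (simp add: algebra_simps)
    then have "[a = b] (mod int s)"
      unfolding cong_iff_lin by blast
    then show False
      using transversal_unique[OF A] that by blast
  qed
  have card_runner: "int (card (runner a)) = a div int s + int M" if "a \<in> A" for a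
  proof -
    have "inj_on (\<lambda>j. a - int s * int j) {1..h a}"
      using s by (auto simp: inj_on_def)
    then show ?thesis
      using nonneg[OF that] by (simp add: runner_def card_image h_def)
  qed
  have "card (\<Union>a\<in>A. runner a) = (\<Sum>a\<in>A. card (runner a))"
    using transversal_finite[OF A] disj by (intro card_UN_disjoint) (auto simp: runner_def)
  then have card: "int (card (abacus s A \<inter> {- int (s * M)..})) = (\<Sum>a\<in>A. a div int s) + int (s * M)"
    unfolding eq by (simp add: card_runner sum.distrib transversal_card[OF A])
  have below: "x \<in> abacus s A" if "x < - int (s * M)" for x
  proof -
    obtain a where a: "a \<in> A" "[a = x] (mod int s)"
      using transversal_ex[OF A s] by blast
    have "x < a"
      using low[OF a(1)] that by simp
    then obtain j where "1 \<le> j" "x = a - int s * int j"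
      using cong_less_imp[OF cong_sym[OF a(2)]] by blast
    then show ?thesis
      using a(1) by (auto simp: abacus_def)
  qed
  have fin: "finite (abacus s A \<inter> {- int (s * M)..})"
    unfolding eq using transversal_finite[OF A] by (auto simp: runner_def)
  have mods: "(\<Sum>a\<in>A. a mod int s) = (\<Sum>r\<in>{0..<int s}. r)"
    using A unfolding transversal_def by (rule sum.reindex_bij_betw)
  have "(\<Sum>a\<in>A. a) = (\<Sum>a\<in>A. int s * (a div int s) + a mod int s)"
    by simp
  also have "\<dots> = int s * (\<Sum>a\<in>A. a div int s) + (\<Sum>r\<in>{0..<int s}. r)"
    by (simp only: sum.distrib mods sum_distrib_left)
  finally have "(\<Sum>a\<in>A. a) = (\<Sum>r\<in>{0..<int s}. r) \<longleftrightarrow> (\<Sum>a\<in>A. a div int s) = 0"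
    using s by simp
  moreover have "charge_free (abacus s A) (s * M) \<longleftrightarrow> (\<Sum>a\<in>A. a div int s) = 0"
  proof -
    have "card (abacus s A \<inter> {- int (s * M)..}) = s * M \<longleftrightarrow> (\<Sum>a\<in>A. a div int s) = 0"
      using card by linarith
    then show ?thesis
      unfolding charge_free_def using below fin by blast
  qed
  ultimately show ?thesis by simp
qed

lemma charge_free_abacus:
  assumes s: "s > 0" and A: "transversal s A"
  shows "(\<exists>N. charge_free (abacus s A) N) \<longleftrightarrow> (\<Sum>a\<in>A. a) = (\<Sum>r\<in>{0..<int s}. r)"
proof -
  obtain K where K: "\<And>a. a \<in> A \<Longrightarrow> - int K \<le> a"
  proof -
    have "\<exists>b. \<forall>a\<in>A. b \<le> a"
      using bdd_below_finite[OF transversal_finite[OF A]] by (simp add: bdd_below_def)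
    then obtain b where "\<forall>a\<in>A. b \<le> a" ..
    then show ?thesis
      by (intro that[of "nat (- b)"]) fastforce
  qed
  have le_mult: "M \<le> s * M" for M
    using s by simp
  have "charge_free (abacus s A) (s * M) \<longleftrightarrow> (\<Sum>a\<in>A. a) = (\<Sum>r\<in>{0..<int s}. r)" if "K \<le> M" for M
  proof (rule charge_free_abacus_iff[OF s A])
    fix a assume "a \<in> A"
    have "K \<le> s * M"
      using that le_mult by (rule le_trans)
    then show "- int (s * M) \<le> a"
      using K[OF \<open>a \<in> A\<close>] by linarith
  qed
  moreover have "charge_free (abacus s A) (s * max K N)" if "charge_free (abacus s A) N" for N
  proof (rule charge_free_mono[OF that])
    show "N \<le> s * max K N"
      using max.cobounded2 le_mult by (rule le_trans)
  qed
  ultimately show ?thesis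
    by (metis max.cobounded1)
qed

lemma s_set_frontier:
  assumes "s > 0" and "charge_free (beta_set lam) N"
    and closed: "\<forall>b\<in>beta_set lam. b - int s \<in> beta_set lam"
  shows "s_set s lam = frontier s (beta_set lam)"
proof -
  let ?B = "beta_set lam"
  have least: "(LEAST y. y \<in> cong_class s a \<and> y \<notin> ?B) = a" if "a \<in> frontier s ?B" for a
    by (rule Least_equality)
      (use that frontier_le[OF closed that] in \<open>auto simp: frontier_def mem_cong_class\<close>)
  have "cong_class s x = cong_class s a" if "[a = x] (mod int s)" for a x
    using that unfolding cong_class_def by (metis cong_trans cong_sym)
  then have same: "\<exists>a\<in>frontier s ?B. cong_class s x = cong_class s a" for x
    using frontier_ex[OF assms(1,2), of x] by blast
  show ?thesis
  proof (intro equalityI subsetI)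
    fix y assume "y \<in> s_set s lam"
    then obtain x where "y = (LEAST z. z \<in> cong_class s x \<and> z \<notin> ?B)"
      by (auto simp: s_set_def residue_classes_eq)
    then show "y \<in> frontier s ?B"
      using same[of x] least by metis
  next
    fix a assume "a \<in> frontier s ?B"
    then have "a = (LEAST z. z \<in> cong_class s a \<and> z \<notin> ?B)"
      by (simp add: least)
    then show "a \<in> s_set s lam"
      unfolding s_set_def residue_classes_eq by blast
  qed
qed

section \<open>Counting the stabiliser\<close>

text \<open>
  A permutation that preserves a function is a free choice of a permutation of each fibre.
\<close>

lemma card_permutes_preserving:
  assumes A: "finite A" and I: "finite I" and f: "f ` A \<subseteq> I"
  shows "card {p. p permutes A \<and> (\<forall>a\<in>A. f (p a) = f a)} =
    (\<Prod>i\<in>I. fact (card {a \<in> A. f a = i}))"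
proof -
  let ?P = "{p. p permutes A \<and> (\<forall>a\<in>A. f (p a) = f a)}"
  let ?A = "\<lambda>i. {a \<in> A. f a = i}"
  let ?Q = "\<Pi>\<^sub>E i\<in>I. {p. p permutes ?A i}"
  define split where "split = (\<lambda>p. \<lambda>i\<in>I. \<lambda>a. if a \<in> ?A i then p a else a)"
  define glue where "glue = (\<lambda>q a. if a \<in> A then q (f a) a else a)"
  have f_in: "f a \<in> I" if "a \<in> A" for a
    using that f by blast
  have glue_in: "q i a \<in> ?A i" if q: "q \<in> ?Q" and a: "a \<in> ?A i" "i \<in> I" for q i a
  proof -
    have "q i permutes ?A i"
      using q a(2) by (auto dest: PiE_mem)
    then show ?thesis
      using a(1) permutes_in_image by metis
  qed
  have "bij_betw split ?P ?Q"
  proof (rule bij_betw_byWitness[where f' = glue])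
    show "\<forall>p\<in>?P. glue (split p) = p"
      by (auto simp: glue_def split_def fun_eq_iff f_in permutes_not_in)
    show "\<forall>q\<in>?Q. split (glue q) = q"
    proof
      fix q assume q: "q \<in> ?Q"
      show "split (glue q) = q"
      proof (rule extensionalityI)
        show "split (glue q) \<in> extensional I" "q \<in> extensional I"
          using q by (auto simp: split_def PiE_def)
        fix i assume i: "i \<in> I"
        then have "q i permutes ?A i"
          using q by (auto dest: PiE_mem)
        then have "q i a = a" if "a \<notin> ?A i" for a
          using that by (rule permutes_not_in)
        then show "split (glue q) i = q i"
          using i by (auto simp: split_def glue_def fun_eq_iff)
      qed
    qed
    show "split ` ?P \<subseteq> ?Q"
    proof (intro subsetI, elim imageE)
      fix q p assume q: "q = split p" and "p \<in> ?P"
      then have p: "p permutes A" "\<And>a. a \<in> A \<Longrightarrow> f (p a) = f a"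
        by auto
      show "q \<in> ?Q"
        unfolding q
      proof (rule PiE_I)
        fix i assume i: "i \<in> I"
        have "p ` ?A i \<subseteq> ?A i"
          using p permutes_in_image[OF p(1)] by auto
        moreover have inj: "inj_on p (?A i)"
          using permutes_inj[OF p(1)] by (rule inj_on_subset) simp
        ultimately have "p ` ?A i = ?A i"
          using A by (intro endo_inj_surj) simp_all
        then have "bij_betw p (?A i) (?A i)"
          using inj by (simp add: bij_betw_def)
        then have "bij_betw (split p i) (?A i) (?A i)"
          by (rule bij_betw_cong[THEN iffD1, rotated]) (simp add: split_def i)
        moreover have "split p i a = a" if "a \<notin> ?A i" for a
          unfolding split_def using i that by auto
        ultimately have "split p i permutes ?A i"
          by (rule bij_imp_permutes)
        then show "split p i \<in> {p. p permutes ?A i}"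
          by simp
      qed (simp add: split_def)
    qed
    show "glue ` ?Q \<subseteq> ?P"
    proof (intro subsetI, elim imageE)
      fix p q assume p: "p = glue q" and q: "q \<in> ?Q"
      have pres: "glue q a \<in> A \<and> f (glue q a) = f a" if "a \<in> A" for a
        using glue_in[OF q, of a "f a"] that f_in[OF that] by (simp add: glue_def)
      have "inj_on (glue q) A"
      proof (rule inj_onI)
        fix a b assume ab: "a \<in> A" "b \<in> A" "glue q a = glue q b"
        then have eq: "f a = f b"
          using pres by metis
        have "q (f a) permutes ?A (f a)"
          using q f_in[OF ab(1)] by (auto dest: PiE_mem)
        then have "inj (q (f a))"
          by (rule permutes_inj)
        moreover have "q (f a) a = q (f a) b"
          using ab eq by (simp add: glue_def)
        ultimately show "a = b"
          by (rule injD)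
      qed
      moreover have "glue q ` A \<subseteq> A"
        using pres by blast
      ultimately have "bij_betw (glue q) A A"
        using A by (simp add: bij_betw_def endo_inj_surj)
      then have "glue q permutes A"
        by (rule bij_imp_permutes) (simp add: glue_def)
      then show "p \<in> ?P"
        using pres p by simp
    qed
  qed
  then have "card ?P = card ?Q"
    by (rule bij_betw_same_card)
  also have "\<dots> = (\<Prod>i\<in>I. fact (card (?A i)))"
    using I A by (simp add: card_PiE card_permutations)
  finally show ?thesis .
qed

context coprime_level
begin

text \<open>
  The displacements of \<open>w\<close> are summed over the indices of \<open>A\<close>, which again form a transversal, so
  the level action leaves the sum of a transversal unchanged. Together with the charge criterion this
  is why it maps beta-sets of \<open>s\<close>-cores to beta-sets of partitions.
\<close>

lemma sum_level_perm:
  assumes A: "transversal s A" and w: "w \<in> carrier (affine_sym s)"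
  shows "(\<Sum>a\<in>level_perm w ` A. a) = (\<Sum>a\<in>A. a)"
proof -
  have s: "s > 0"
    using s2 by simp
  have index_inj: "a = b" if "a \<in> A" "b \<in> A" "[index a = index b] (mod int s)" for a b
  proof -
    have "[b = index b * int t - circ s t] (mod int s)"
      by (rule index_self)
    moreover have "[a = index b * int t - circ s t] (mod int s)"
      using that(3) by (simp add: index_cong_iff)
    ultimately have "[a = b] (mod int s)"
      using cong_trans cong_sym by blast
    then show ?thesis
      using transversal_unique[OF A] that(1,2) by blast
  qed
  then have inj: "inj_on index A"
    using cong_refl by (auto intro!: inj_onI)
  have "transversal s (index ` A)"
  proof (rule transversalI_card)
    show "card (index ` A) = s"
      using inj transversal_card[OF A] by (simp add: card_image)
    fix x y assume "x \<in> index ` A" "y \<in> index ` A" "[x = y] (mod int s)"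
    then show "x = y"
      using index_inj by blast
  qed (use s transversal_finite[OF A] in auto)
  then have "(\<Sum>k\<in>index ` A. w k - k) = 0"
    using affine_sum_zero[OF w] by (subst sum_transversal) (simp_all add: affine_shift[OF w])
  then have "(\<Sum>a\<in>A. w (index a) - index a) = 0"
    using inj by (simp add: sum.reindex)
  then have "(\<Sum>a\<in>A. level_perm w a) = (\<Sum>a\<in>A. a)"
    by (simp add: level_perm_def sum.distrib flip: sum_distrib_left)
  moreover have "inj_on (level_perm w) A"
    using bij_is_inj[OF bij_level_perm[OF w]] by (rule inj_on_subset) simp
  ultimately show ?thesis
    by (simp add: sum.reindex)
qed

lemma level_perm_abacus:
  assumes w: "w \<in> carrier (affine_sym s)"
  shows "level_perm w ` abacus s A = abacus s (level_perm w ` A)"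
proof -
  have shift: "level_perm w (a - int s * int j) = level_perm w a - int s * int j" for a j
  proof -
    have "level_perm w (a - int s * int j) - (a - int s * int j) = level_perm w a - a"
      by (rule displacement_cong[where s = s]) (simp_all add: level_perm_shift[OF w] cong_iff_dvd_diff)
    then show ?thesis by simp
  qed
  then show ?thesis
    unfolding abacus_def by (auto simp: image_iff) (metis shift)+
qed

text \<open>
  The image of the beta-set really is the beta-set of a partition, by conservation of the charge;
  without this the action on cores would be an unspecified choice.
  The fixed-point condition then passes from beta-sets to their frontiers.
\<close>

lemma core_action_fixes_iff:
  assumes lam: "lam \<in> cores s" and w: "w \<in> carrier (affine_sym s)"
  shows "core_action s t w lam = lam \<longleftrightarrow> level_perm w ` s_set s lam = s_set s lam"
proof -
  have s: "s > 0"
    using s2 by simp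
  let ?B = "beta_set lam" and ?f = "level_perm w"
  have part: "is_partition lam"
    using lam by (simp add: cores_def)
  obtain N where N: "charge_free ?B N"
    using charge_free_beta_set[OF part] ..
  have closed: "\<forall>b\<in>?B. b - int s \<in> ?B"
    using core_beta_set_closed[OF lam s] by blast
  define A where "A = frontier s ?B"
  have A: "transversal s A"
    unfolding A_def by (rule transversal_frontier[OF s N closed])
  have B: "?B = abacus s A"
    unfolding A_def by (rule abacus_frontier[OF s N closed, symmetric])
  have fA: "transversal s (?f ` A)"
    using bij_is_inj[OF bij_level_perm[OF w]] level_perm_shift[OF w]
    by (intro transversal_image[OF s A])
  have fB: "?f ` ?B = abacus s (?f ` A)"
    unfolding B by (rule level_perm_abacus[OF w])
  have "(\<Sum>a\<in>A. a) = (\<Sum>r\<in>{0..<int s}. r)"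
    using charge_free_abacus[OF s A] N B by auto
  then obtain M where "charge_free (?f ` ?B) M"
    using charge_free_abacus[OF s fA] sum_level_perm[OF A w] fB by auto
  then obtain mu where mu: "is_partition mu" "beta_set mu = ?f ` ?B"
    using partition_of_charge_free by blast
  have "core_action s t w lam = (THE mu. is_partition mu \<and> beta_set mu = ?f ` ?B)"
    using lam by (simp add: core_action_def level_action_eq[OF w])
  also have "\<dots> = mu"
    using mu beta_set_inject by (intro the_equality) auto
  finally have "core_action s t w lam = lam \<longleftrightarrow> ?f ` ?B = ?B"
    using mu beta_set_inject[OF mu(1) part] by auto
  also have "\<dots> \<longleftrightarrow> ?f ` A = A"
    using frontier_abacus[OF s A] frontier_abacus[OF s fA] B fB by metis
  finally show ?thesis
    using s_set_frontier[OF s N closed] by (simp add: A_def)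
qed

text \<open>
  The level action moves \<open>a\<close> by \<open>t\<close> times a displacement, so the displacement of \<open>w\<close> at the index
  of \<open>a\<close> has to be \<open>(p a - a) / t\<close>. As \<open>A\<close> meets every class once, this prescribes \<open>w\<close> completely.
  It is bijective because \<open>p\<close> is, and its displacements add up to \<open>0\<close> because \<open>A\<close> and \<open>p ` A\<close>
  have the same sum.
\<close>

lemma affine_from_permutation:
  assumes A: "transversal s A" and p: "p permutes A"
    and pres: "\<And>a. a \<in> A \<Longrightarrow> [p a = a] (mod int t)"
  shows "\<exists>w\<in>carrier (affine_sym s). \<forall>a\<in>A. level_perm w a = p a"
proof -
  have s: "s > 0"
    using s2 by simp
  \<comment> \<open>the element of \<open>A\<close> that has index \<open>k\<close>\<close>
  define rep where "rep = (\<lambda>k. SOME a. a \<in> A \<and> [a = k * int t - circ s t] (mod int s))"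
  have rep: "rep k \<in> A \<and> [rep k = k * int t - circ s t] (mod int s)" for k
    unfolding rep_def by (rule someI_ex) (use transversal_ex[OF A s] in blast)
  have rep_eq: "rep k = a" if "a \<in> A" "[index a = k] (mod int s)" for k a
  proof -
    have "[a = k * int t - circ s t] (mod int s)"
      using that(2) by (simp add: index_cong_iff)
    then have "[rep k = a] (mod int s)"
      using rep[of k] cong_trans cong_sym by blast
    then show ?thesis
      using transversal_unique[OF A] rep that(1) by blast
  qed
  have index_rep: "[index (rep k) = k] (mod int s)" for k
    using rep by (simp add: index_cong_iff)
  define w where "w = (\<lambda>k. k + (p (rep k) - rep k) div int t)"
  have w_mult: "int t * (w k - k) = p (rep k) - rep k" for k
    using pres[of "rep k"] rep by (simp add: w_def cong_iff_dvd_diff)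
  have shift: "w (k + int s) = w k + int s" for k
  proof -
    have "[index (rep k) = k + int s] (mod int s)"
      using index_rep[of k] by (simp add: cong_def)
    then have "rep (k + int s) = rep k"
      using rep by (intro rep_eq) auto
    then show ?thesis
      by (simp add: w_def)
  qed
  have index_w: "[index (p (rep k)) = w k] (mod int s)" for k
  proof -
    have "[rep k + int t * (w k - k) = k * int t - circ s t + int t * (w k - k)] (mod int s)"
      using rep by (intro cong_add) auto
    moreover have "rep k + int t * (w k - k) = p (rep k)"
      by (simp add: w_mult)
    moreover have "k * int t - circ s t + int t * (w k - k) = w k * int t - circ s t"
      by (simp add: algebra_simps)
    ultimately have "[p (rep k) = w k * int t - circ s t] (mod int s)"
      by metis
    then show ?thesis
      by (simp add: index_cong_iff)
  qed
  have rep_w: "rep (w k) = p (rep k)" for k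
    using index_w rep permutes_in_image[OF p] by (intro rep_eq) auto
  have inj_p: "p x = p y \<Longrightarrow> x = y" for x y
    using permutes_inj[OF p] by (rule injD)
  have "inj w"
  proof (rule injI)
    fix k l assume kl: "w k = w l"
    then have "p (rep k) = p (rep l)"
      using rep_w by metis
    then have "rep k = rep l"
      by (rule inj_p)
    then show "k = l"
      using kl by (simp add: w_def)
  qed
  moreover have "surj w"
    unfolding surj_def
  proof
    fix k
    obtain a where a: "a \<in> A" "p a = rep k"
      using permutes_image[OF p] rep by (metis imageE)
    \<comment> \<open>\<open>w\<close> sends the index of \<open>a\<close> to that of \<open>p a\<close>, so the preimage undoes the displacement at \<open>a\<close>\<close>
    let ?l = "k - (p a - a) div int t"
    have "int t * ((p a - a) div int t) = p a - a"
      using pres[OF a(1)] by (simp add: cong_iff_dvd_diff)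
    then have "k * int t - circ s t - (p a - a) = ?l * int t - circ s t"
      by (simp add: algebra_simps)
    moreover have "[p a - (p a - a) = k * int t - circ s t - (p a - a)] (mod int s)"
      using rep a by (intro cong_diff) auto
    moreover have "p a - (p a - a) = a"
      by simp
    ultimately have "[a = ?l * int t - circ s t] (mod int s)"
      by metis
    then have "[index a = ?l] (mod int s)"
      by (simp add: index_cong_iff)
    then have "rep ?l = a"
      by (rule rep_eq[OF a(1)])
    then have "k = w ?l"
      by (simp add: w_def)
    then show "\<exists>l. k = w l" ..
  qed
  ultimately have "bij w"
    by (rule bijI)
  moreover have "(\<Sum>k\<in>{0..<int s}. w k - k) = 0"
  proof -
    have "transversal s (index ` A)"
    proof (rule transversalI[OF s])
      fix x y assume "x \<in> index ` A" "y \<in> index ` A" "[x = y] (mod int s)"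
      then show "x = y"
        using rep_eq cong_refl by (metis imageE)
    next
      fix m show "\<exists>x\<in>index ` A. [x = m] (mod int s)"
        using index_rep rep by blast
    qed
    then have "(\<Sum>k\<in>{0..<int s}. w k - k) = (\<Sum>k\<in>index ` A. w k - k)"
      by (rule sum_transversal[symmetric]) (simp add: shift)
    also have "\<dots> = (\<Sum>a\<in>A. w (index a) - index a)"
    proof (rule sum.reindex_cong[where l = index])
      show "inj_on index A"
        using rep_eq cong_refl by (metis inj_onI)
    qed simp_all
    finally have "int t * (\<Sum>k\<in>{0..<int s}. w k - k) = (\<Sum>a\<in>A. p a - a)"
      by (simp add: sum_distrib_left w_mult rep_eq)
    also have "\<dots> = 0"
      using sum.permute[OF p, of "\<lambda>a. a"] by (simp add: sum_subtractf comp_def)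
    finally show ?thesis
      using t1 by simp
  qed
  ultimately have "w \<in> carrier (affine_sym s)"
    by (simp add: affine_sym_iff shift)
  moreover have "level_perm w a = p a" if "a \<in> A" for a
    using that by (simp add: level_perm_def w_mult rep_eq)
  ultimately show ?thesis by blast
qed

lemma level_perm_determined:
  assumes A: "transversal s A"
    and v: "v \<in> carrier (affine_sym s)" and w: "w \<in> carrier (affine_sym s)"
    and eq: "\<And>a. a \<in> A \<Longrightarrow> level_perm v a = level_perm w a"
  shows "v = w"
proof
  fix k
  obtain a where a: "a \<in> A" "[a = k * int t - circ s t] (mod int s)"
    using transversal_ex[OF A] s2 by fastforce
  have "int t * (v k - k) = int t * (w k - k)"
    using eq[OF a(1)] level_perm_cong[OF v a(2)] level_perm_cong[OF w a(2)] by simp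
  then show "v k = w k"
    using t1 by simp
qed

text \<open>
  Restriction to the \<open>s\<close>-set identifies the stabiliser with the permutations of the \<open>s\<close>-set that
  preserve classes modulo \<open>t\<close>.
\<close>

lemma card_stabilizer:
  assumes lam: "lam \<in> cores s" and A: "transversal s (s_set s lam)"
  shows "card (stabilizer (affine_sym s) (core_action s t) lam) =
    (\<Prod>i\<in>residue_classes t. fact (card (s_set s lam \<inter> i)))"
proof -
  let ?A = "s_set s lam" and ?S = "stabilizer (affine_sym s) (core_action s t) lam"
  let ?P = "{p. p permutes ?A \<and> (\<forall>a\<in>?A. cong_class t (p a) = cong_class t a)}"
  have class_eq: "cong_class t x = cong_class t y \<longleftrightarrow> [x = y] (mod int t)" for x y
    unfolding cong_class_def set_eq_iff mem_Collect_eq by (metis cong_trans cong_sym cong_refl)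
  have S: "?S = {w \<in> carrier (affine_sym s). level_perm w ` ?A = ?A}"
    using core_action_fixes_iff[OF lam] by (auto simp: stabilizer_def)
  define r where "r = (\<lambda>w a. if a \<in> ?A then level_perm w a else a)"
  have "bij_betw r ?S ?P"
  proof (rule bij_betw_imageI)
    show "inj_on r ?S"
    proof (rule inj_onI)
      fix v w assume "v \<in> ?S" "w \<in> ?S" and eq: "r v = r w"
      moreover have "level_perm v a = level_perm w a" if "a \<in> ?A" for a
        using fun_cong[OF eq, of a] that by (simp add: r_def)
      ultimately show "v = w"
        by (intro level_perm_determined[OF A]) (simp_all add: S)
    qed
    show "r ` ?S = ?P"
    proof (intro equalityI subsetI)
      fix p assume "p \<in> r ` ?S"
      then obtain w where w: "w \<in> carrier (affine_sym s)" "level_perm w ` ?A = ?A" "p = r w"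
        by (auto simp: S)
      have "inj_on (level_perm w) ?A"
        using bij_is_inj[OF bij_level_perm[OF w(1)]] by (rule inj_on_subset) simp
      then have "bij_betw (level_perm w) ?A ?A"
        using w(2) by (simp add: bij_betw_def)
      then have "bij_betw p ?A ?A"
        by (rule bij_betw_cong[THEN iffD1, rotated]) (simp add: w(3) r_def)
      then have "p permutes ?A"
        by (rule bij_imp_permutes) (simp add: w(3) r_def)
      moreover have "[p a = a] (mod int t)" if "a \<in> ?A" for a
        using that by (simp add: w(3) r_def level_perm_def cong_iff_dvd_diff)
      ultimately show "p \<in> ?P"
        by (simp add: class_eq)
    next
      fix p assume "p \<in> ?P"
      then have p: "p permutes ?A" "\<And>a. a \<in> ?A \<Longrightarrow> [p a = a] (mod int t)"
        by (simp_all add: class_eq)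
      obtain w where w: "w \<in> carrier (affine_sym s)" "\<forall>a\<in>?A. level_perm w a = p a"
        using affine_from_permutation[OF A p] by blast
      then have "level_perm w ` ?A = ?A"
        using permutes_image[OF p(1)] by simp
      then have "w \<in> ?S"
        using w(1) by (simp add: S)
      moreover have "r w = p"
        using w(2) permutes_not_in[OF p(1)] by (auto simp: r_def fun_eq_iff)
      ultimately show "p \<in> r ` ?S" by blast
    qed
  qed
  then have "card ?S = card ?P"
    by (rule bij_betw_same_card)
  also have "\<dots> = (\<Prod>i\<in>residue_classes t. fact (card {a \<in> ?A. cong_class t a = i}))"
  proof (rule card_permutes_preserving)
    show "finite ?A"
      using A by (rule transversal_finite)
    have "residue_classes t = cong_class t ` {0..<int t}"
    proof -
      have "cong_class t x = cong_class t (x mod int t)" for x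
        by (simp add: class_eq cong_def)
      moreover have "x mod int t \<in> {0..<int t}" for x
        using t1 by simp
      ultimately show ?thesis
        unfolding residue_classes_eq by blast
    qed
    then show "finite (residue_classes t)"
      by simp
    show "cong_class t ` ?A \<subseteq> residue_classes t"
      by (auto simp: residue_classes_eq)
  qed
  also have "\<dots> = (\<Prod>i\<in>residue_classes t. fact (card (?A \<inter> i)))"
  proof (rule prod.cong[OF refl])
    fix i assume "i \<in> residue_classes t"
    then obtain x where "i = cong_class t x"
      by (auto simp: residue_classes_eq)
    then have "{a \<in> ?A. cong_class t a = i} = ?A \<inter> i"
      by (auto simp: class_eq mem_cong_class)
    then show "fact (card {a \<in> ?A. cong_class t a = i}) = fact (card (?A \<inter> i))"
      by simp
  qed
  finally show ?thesis .
qed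

end

theorem proposition3p7:
  fixes s t :: nat and lam :: "nat \<Rightarrow> nat"
  assumes "s \<ge> 2" and "t \<ge> 1" and "coprime s t" and "lam \<in> cores s"
  shows "card (stabilizer (affine_sym s) (core_action s t) lam) =
    (\<Prod>i\<in>residue_classes t. fact (card (s_set s lam \<inter> i)))"
proof -
  interpret coprime_level s t
    using assms(1-3) by unfold_locales
  have s: "s > 0"
    using assms(1) by simp
  have "is_partition lam"
    using assms(4) by (simp add: cores_def)
  then obtain N where N: "charge_free (beta_set lam) N"
    using charge_free_beta_set by blast
  have closed: "\<forall>b\<in>beta_set lam. b - int s \<in> beta_set lam"
    using core_beta_set_closed[OF assms(4) s] by blast
  have "transversal s (s_set s lam)"
    unfolding s_set_frontier[OF s N closed] by (rule transversal_frontier[OF s N closed])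
  then show ?thesis
    by (rule card_stabilizer[OF assms(4)])
qed

end
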